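(* Consider the problem of minimizing $f(x)=\mathbb{E}[F(x;\omega)]$ over $x\in\mathcal{X}$, where $F(x;\omega)$ is continuously differentiable in $x$ for almost all $\omega\in\Omega$ and there is a finite $V\ge 0$ with $\mathbb{E}[\|\nabla F(x;\omega)\|_2^2]\le V^2$ for all $x\in\mathcal{X}$. If this problem is a generic linear program, then the last iterate $X_n$ of (lazy) stochastic gradient descent reaches its (necessarily unique) solution $x^*$ in a finite number of steps almost surely, i.e. $\mathbb{P}(X_n=x^*\text{ for all sufficiently large }n)=1$.
   Context: $\mathcal{X}$ is a nonempty compact convex subset of $\mathbb{R}^d$ (with Euclidean norm $\|\cdot\|_2$), $(\Omega,\mathcal{F},\mathbb{P})$ is a complete probability space, $F:\mathcal{X}\times\Omega\to\mathbb{R}$ is a stochastic objective, and $f(x)=\mathbb{E}[F(x;\omega)]$; gradients are with respect to $x$. Generic linear program: $\mathcal{X}$ is a polytope, $f:\mathcal{X}\to\mathbb{R}$ is affine, and $f$ is constant only on the zero-dimensional faces of $\mathcal{X}$ (i.e. $f$ is non-constant on every face of dimension at least one). Stochastic gradient descent (SGD, lazy version): $X_n=\Pi(Y_n)$, $Y_{n+1}=Y_n-\gamma_n\nabla F(X_n;\omega_n)$, $n=1,2,\dots$, where $\Pi(y)=\arg\min_{x\in\mathcal{X}}\|y-x\|_2$ is the Euclidean projection onto $\mathcal{X}$, $Y_1\in\mathbb{R}^d$ is an arbitrary deterministic initialization, $\omega_n$ are i.i.d. samples distributed according to $\mathbb{P}$, and the step-sizes $\gamma_n>0$ satisfy $\sum_n\gamma_n^2<\infty$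 and $\sum_n\gamma_n=\infty$. *)

theory Defs
  imports "HOL-Probability.Probability"
begin

text \<open>
  The gradient is taken relative to \<open>S\<close>, because the objective is only defined on the feasible
  set and \<open>S\<close> may be lower-dimensional. If the convex set \<open>S\<close> has nonempty interior, \<open>g\<close> is uniquely
  determined on \<open>S\<close>, boundary included. Otherwise only its component along the affine hull of \<open>S\<close>
  is determined, and any continuous choice of the normal component is admitted.
\<close>
definition C1_with_gradient_on ::
    "'a::euclidean_space set \<Rightarrow> ('a \<Rightarrow> real) \<Rightarrow> ('a \<Rightarrow> 'a) \<Rightarrow> bool" where
  "C1_with_gradient_on S \<phi> g \<longleftrightarrow>
     (\<forall>x\<in>S. (\<phi> has_derivative (\<lambda>h. g x \<bullet> h)) (at x within S)) \<and> continuous_on S g"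

definition affine_function_on :: "'a::euclidean_space set \<Rightarrow> ('a \<Rightarrow> real) \<Rightarrow> bool" where
  "affine_function_on S f \<longleftrightarrow> (\<exists>c b. \<forall>x\<in>S. f x = c \<bullet> x + b)"

text \<open>In the library, the empty set is also a face (of dimension \<open>-1\<close>), so it is excluded here.\<close>
definition generic_linear_program :: "'a::euclidean_space set \<Rightarrow> ('a \<Rightarrow> real) \<Rightarrow> bool" where
  "generic_linear_program S f \<longleftrightarrow>
     polytope S \<and> affine_function_on S f \<and>
     (\<forall>C. C face_of S \<and> C \<noteq> {} \<and> f constant_on C \<longrightarrow> aff_dim C = 0)"

definition minimizers_on :: "'a set \<Rightarrow> ('a \<Rightarrow> real) \<Rightarrow> 'a set" where
  "minimizers_on S f = {x \<in> S. \<forall>y\<in>S. f x \<le> f y}"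

text \<open>
  One trajectory of lazy SGD: \<open>w\<close> is a realization of the sample sequence. The iterates are indexed
  from \<open>1\<close>, and the values at index \<open>0\<close> are irrelevant.
\<close>
definition lazy_sgd_path ::
    "'a::euclidean_space set \<Rightarrow> ('a \<Rightarrow> 'w \<Rightarrow> 'a) \<Rightarrow> (nat \<Rightarrow> real) \<Rightarrow> 'a \<Rightarrow>
      (nat \<Rightarrow> 'w) \<Rightarrow> (nat \<Rightarrow> 'a) \<Rightarrow> (nat \<Rightarrow> 'a) \<Rightarrow> bool" where
  "lazy_sgd_path S G \<gamma> y1 w X Y \<longleftrightarrow>
     Y 1 = y1 \<and>
     (\<forall>n\<ge>1. X n = closest_point S (Y n) \<and> Y (Suc n) = Y n - \<gamma> n *\<^sub>R G (X n) (w n))"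

definition iid_samples :: "'s measure \<Rightarrow> 'w measure \<Rightarrow> (nat \<Rightarrow> 's \<Rightarrow> 'w) \<Rightarrow> bool" where
  "iid_samples S M W \<longleftrightarrow>
     prob_space.indep_vars S (\<lambda>_. M) W {1..} \<and> (\<forall>n\<ge>1. distr S M (W n) = M)"

end

theory Submission
  imports Defs "HOL-Real_Asymp.Real_Asymp"
begin

text \<open>
  On \<open>\<X>\<close> the mean gradient acts on feasible directions as the constant vector \<open>c\<close> defining \<open>f\<close>: the
  difference quotients of \<open>F\<close> are bounded in \<open>L\<^sup>2\<close>, so differentiation and expectation commute. By
  genericity the face on which \<open>f\<close> is minimal is a single vertex \<open>x\<^sup>*\<close>, and \<open>c \<bullet> (v - x\<^sup>*) > 0\<close> for all other
  vertices \<open>v\<close>. Hence \<open>(Y\<^sub>n - x\<^sup>*) \<bullet> (v - x\<^sup>*)\<close> is a drift tending to \<open>-\<infinity>\<close>, because the step sizes are not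
  summable, plus a sum of martingale differences, which is almost surely bounded because they are square
  summable. So \<open>Y\<^sub>n\<close> ends up in the normal cone of \<open>\<X>\<close> at \<open>x\<^sup>*\<close>, where the projection equals \<open>x\<^sup>*\<close>.
\<close>

section \<open>Preliminaries: joint measurability, convergence of expectations, Riemann sums\<close>

text \<open>Moving \<open>x\<close> to a point of a countable dense set within
  \<open>1 / Suc n\<close> gives approximants that depend on \<open>x\<close> only through a
  countable index and are therefore jointly measurable; continuity in \<open>x\<close> makes them
  converge pointwise.\<close>

lemma borel_measurable_pair_Caratheodory:
  fixes f :: "'a::euclidean_space \<Rightarrow> 'w \<Rightarrow> 'b::metric_space"
  assumes meas: "\<And>x. f x \<in> borel_measurable M"
    and cont: "\<And>w. w \<in> space M \<Longrightarrow> continuous_on UNIV (\<lambda>x. f x w)"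
  shows "(\<lambda>(x, w). f x w) \<in> borel_measurable (borel \<Otimes>\<^sub>M M)"
proof -
  obtain D :: "'a set" where D: "countable D" "\<And>U. open U \<Longrightarrow> U \<noteq> {} \<Longrightarrow> \<exists>d\<in>D. d \<in> U"
    using countable_dense_setE by blast
  define e where "e = from_nat_into D"
  have e: "\<exists>i. dist (e i) x < 1 / Suc n" for x n
  proof -
    obtain d where "d \<in> D" "d \<in> ball x (1 / Suc n)"
      using D(2)[of "ball x (1 / Suc n)"] by auto
    with D(1) show ?thesis
      unfolding e_def by (metis dist_commute from_nat_into_surj mem_ball)
  qed
  \<comment> \<open>Taking the least admissible index makes the choice a Borel function of
    \<open>x\<close>.\<close>
  define q where "q n x = (LEAST i. dist (e i) x < 1 / Suc n)" for n x
  have q: "dist (e (q n x)) x < 1 / Suc n" for n x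
    unfolding q_def by (rule LeastI_ex[OF e])
  have [measurable]: "q n \<in> measurable borel (count_space UNIV)" for n
    unfolding q_def by measurable
  have [measurable]: "(\<lambda>p. f (e (q n (fst p))) (snd p)) \<in> borel_measurable (borel \<Otimes>\<^sub>M M)" for n
  proof (rule measurable_compose_countable[where f = "\<lambda>i p. f (e i) (snd p)" and g = "\<lambda>p. q n (fst p)"])
    show "(\<lambda>p. f (e i) (snd p)) \<in> borel_measurable (borel \<Otimes>\<^sub>M M)" for i
      by (rule measurable_compose[OF measurable_snd meas])
  qed measurable
  have "(\<lambda>n. f (e (q n (fst p))) (snd p)) \<longlonglongrightarrow> f (fst p) (snd p)" if "p \<in> space (borel \<Otimes>\<^sub>M M)" for p
  proof -
    have "(\<lambda>n. e (q n (fst p))) \<longlonglongrightarrow> fst p"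
    proof (rule metric_LIMSEQ_I)
      fix r :: real assume "r > 0"
      then obtain N where N: "1 / Suc N < r"
        by (metis inverse_eq_divide reals_Archimedean)
      have "dist (e (q n (fst p))) (fst p) < r" if "n \<ge> N" for n
      proof -
        have "1 / real (Suc n) \<le> 1 / Suc N" using that by (intro frac_le) auto
        with q[of n "fst p"] N show ?thesis by linarith
      qed
      then show "\<exists>no. \<forall>n\<ge>no. dist (e (q n (fst p))) (fst p) < r" by blast
    qed
    moreover have "isCont (\<lambda>x. f x (snd p)) (fst p)"
      using cont[of "snd p"] that by (auto simp: continuous_on_eq_continuous_at space_pair_measure)
    ultimately show ?thesis
      by (rule isCont_tendsto_compose[rotated])
  qed
  then have "(\<lambda>p. f (fst p) (snd p)) \<in> borel_measurable (borel \<Otimes>\<^sub>M M)"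
    by (rule borel_measurable_LIMSEQ_metric[rotated]) measurable
  then show ?thesis
    by (simp add: case_prod_beta')
qed

text \<open>Boundedness in L2 gives uniform integrability. With \<open>d n\<close> the distance to
  the limit, the truncation at a level \<open>K\<close> tends to 0 in mean by dominated convergence,
  and the part above \<open>K\<close> is at most \<open>(d n x)\<^sup>2 / K\<close>, with mean at
  most \<open>4 * C / K\<close> uniformly in \<open>n\<close>.\<close>

lemma (in prob_space) tendsto_expectation_L2_bounded:
  fixes D :: "nat \<Rightarrow> 'a \<Rightarrow> real"
  assumes meas: "\<And>n. D n \<in> borel_measurable M" "D' \<in> borel_measurable M"
    and sq: "\<And>n. integrable M (\<lambda>x. (D n x)\<^sup>2)" "integrable M (\<lambda>x. (D' x)\<^sup>2)"
    and bound: "\<And>n. expectation (\<lambda>x. (D n x)\<^sup>2) \<le> C" "expectation (\<lambda>x. (D' x)\<^sup>2) \<le> C"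
    and lim: "AE x in M. (\<lambda>n. D n x) \<longlonglongrightarrow> D' x"
  shows "(\<lambda>n. expectation (D n)) \<longlonglongrightarrow> expectation D'"
proof -
  note [measurable] = meas
  have int: "integrable M (D n)" "integrable M D'" for n
    by (rule square_integrable_imp_integrable[OF meas(1) sq(1)], rule square_integrable_imp_integrable[OF meas(2) sq(2)])
  define d where "d n x = \<bar>D n x - D' x\<bar>" for n x
  have [measurable]: "d n \<in> borel_measurable M" for n
    unfolding d_def by measurable
  have intd: "integrable M (d n)" for n
    unfolding d_def using int by (intro integrable_abs Bochner_Integration.integrable_diff)
  have C0: "C \<ge> 0"
    using bound(2) by (rule order_trans[rotated]) simp
  have dsq_le: "(d n x)\<^sup>2 \<le> 2 * (D n x)\<^sup>2 + 2 * (D' x)\<^sup>2" for n x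
    using zero_le_power2[of "D n x + D' x"] by (simp add: d_def power2_eq_square algebra_simps)
  have dsq: "integrable M (\<lambda>x. (d n x)\<^sup>2)" for n
  proof (rule Bochner_Integration.integrable_bound)
    show "integrable M (\<lambda>x. 2 * (D n x)\<^sup>2 + 2 * (D' x)\<^sup>2)"
      using sq by auto
  qed (use dsq_le in auto)
  have Edsq: "expectation (\<lambda>x. (d n x)\<^sup>2) \<le> 4 * C" for n
  proof -
    have "expectation (\<lambda>x. (d n x)\<^sup>2) \<le> expectation (\<lambda>x. 2 * (D n x)\<^sup>2 + 2 * (D' x)\<^sup>2)"
      using dsq sq dsq_le by (intro integral_mono) auto
    also have "\<dots> = 2 * expectation (\<lambda>x. (D n x)\<^sup>2) + 2 * expectation (\<lambda>x. (D' x)\<^sup>2)"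
      using sq by simp
    finally show ?thesis
      using bound(1)[of n] bound(2) by simp
  qed
  have lim0: "(\<lambda>n. expectation (d n)) \<longlonglongrightarrow> 0"
  proof (rule LIMSEQ_I)
    fix r :: real assume r: "r > 0"
    \<comment> \<open>The term \<open>8 * C / r\<close> brings \<open>4 * C / K\<close> down to at
      most \<open>r / 2\<close>; adding 1 keeps \<open>K\<close> positive when
      \<open>C = 0\<close>.\<close>
    define K where "K = 8 * C / r + 1"
    have K: "K > 0" "4 * C / K < r / 2 + r / 4"
      using C0 r by (auto simp: K_def field_simps add_pos_nonneg)
    have "(\<lambda>n. expectation (\<lambda>x. min (d n x) K)) \<longlonglongrightarrow> expectation (\<lambda>x. 0)"
    proof (rule integral_dominated_convergence[where w = "\<lambda>_. K"])
      show "AE x in M. (\<lambda>n. min (d n x) K) \<longlonglongrightarrow> 0"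
        using lim
      proof eventually_elim
        case (elim x)
        then have "(\<lambda>n. d n x) \<longlonglongrightarrow> \<bar>D' x - D' x\<bar>"
          unfolding d_def by (intro tendsto_intros)
        then have "(\<lambda>n. min (d n x) K) \<longlonglongrightarrow> min 0 K"
          by (intro tendsto_min) auto
        then show ?case using K by simp
      qed
    qed (use K in \<open>auto simp: d_def\<close>)
    then have "\<forall>\<^sub>F n in sequentially. expectation (\<lambda>x. min (d n x) K) < r / 4"
      using r by (intro order_tendstoD(2)) auto
    then obtain N where N: "\<And>n. n \<ge> N \<Longrightarrow> expectation (\<lambda>x. min (d n x) K) < r / 4"
      by (auto simp: eventually_sequentially)
    have "norm (expectation (d n) - 0) < r" if "n \<ge> N" for n
    proof -
      have imin: "integrable M (\<lambda>x. min (d n x) K)"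
        using K by (intro integrable_const_bound[where B = K]) (auto simp: d_def)
      have "d n x \<le> min (d n x) K + (d n x)\<^sup>2 / K" for x
      proof (cases "d n x \<le> K")
        case False
        then have "d n x * K \<le> d n x * d n x" using K by (intro mult_left_mono) auto
        then have "d n x \<le> (d n x)\<^sup>2 / K" using K by (simp add: pos_le_divide_eq power2_eq_square)
        then show ?thesis using K False by simp
      qed (use K in auto)
      then have "expectation (d n) \<le> expectation (\<lambda>x. min (d n x) K + (d n x)\<^sup>2 / K)"
        using intd imin dsq by (intro integral_mono) auto
      also have "\<dots> = expectation (\<lambda>x. min (d n x) K) + expectation (\<lambda>x. (d n x)\<^sup>2) / K"
        using imin dsq by simp
      also have "\<dots> < r / 4 + (r / 2 + r / 4)"
      proof (intro add_strict_mono)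
        have "expectation (\<lambda>x. (d n x)\<^sup>2) / K \<le> 4 * C / K"
          using Edsq K by (intro divide_right_mono) auto
        then show "expectation (\<lambda>x. (d n x)\<^sup>2) / K < r / 2 + r / 4" using K(2) by (rule le_less_trans)
      qed (use N that in auto)
      finally have "expectation (d n) < r" by simp
      moreover have "expectation (d n) \<ge> 0" by (simp add: d_def)
      ultimately show ?thesis by simp
    qed
    then show "\<exists>no. \<forall>n\<ge>no. norm (expectation (d n) - 0) < r" by blast
  qed
  have le: "norm (expectation (D n) - expectation D') \<le> expectation (d n)" for n
  proof -
    have "expectation (D n) - expectation D' = expectation (\<lambda>x. D n x - D' x)"
      using int by simp
    then show ?thesis
      using integral_norm_bound[of M "\<lambda>x. D n x - D' x"] by (simp add: d_def[abs_def])
  qed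
  have "(\<lambda>n. expectation (D n) - expectation D') \<longlonglongrightarrow> 0"
    by (rule Lim_null_comparison[OF always_eventually lim0]) (use le in blast)
  then show ?thesis
    by (rule LIM_zero_cancel)
qed

text \<open>On each cell the mean value theorem turns the increment of \<open>\<psi>\<close> into a
  value of \<open>h\<close>, which uniform continuity compares with the value at the left end.
  Finite sums are convenient later: for them, measurability of the gradient at each fixed point is
  enough.\<close>

lemma Riemann_sums_tendsto:
  fixes \<psi> h :: "real \<Rightarrow> real"
  assumes deriv: "\<And>t. t \<in> {0..1} \<Longrightarrow> (\<psi> has_real_derivative h t) (at t within {0..1})"
    and cont: "continuous_on {0..1} h"
  shows "(\<lambda>n. (\<Sum>k<Suc n. h (k / Suc n)) / Suc n) \<longlonglongrightarrow> \<psi> 1 - \<psi> 0"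
proof (rule LIMSEQ_I)
  fix r :: real assume r: "r > 0"
  have "uniformly_continuous_on {0..1} h"
    by (intro compact_uniformly_continuous cont) auto
  then obtain \<delta> where \<delta>: "\<delta> > 0"
    "\<And>s t. s \<in> {0..1} \<Longrightarrow> t \<in> {0..1} \<Longrightarrow> dist s t < \<delta> \<Longrightarrow> dist (h s) (h t) < r / 2"
    using r unfolding uniformly_continuous_on_def by (metis half_gt_zero)
  obtain N where N: "1 / Suc N < \<delta>"
    using \<delta>(1) by (metis inverse_eq_divide reals_Archimedean)
  have "norm ((\<Sum>k<Suc n. h (k / Suc n)) / Suc n - (\<psi> 1 - \<psi> 0)) < r" if n: "n \<ge> N" for n
  proof -
    define m where "m = real (Suc n)"
    have m: "m > 0" by (simp add: m_def)
    have m\<delta>: "1 / m < \<delta>"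
      using N n by (intro le_less_trans[OF _ N]) (simp add: m_def frac_le)
    have step: "\<bar>h (k / m) / m - (\<psi> (Suc k / m) - \<psi> (k / m))\<bar> \<le> r / 2 / m" if "k < Suc n" for k
    proof -
      have kI: "real k / m \<ge> 0" "Suc k / m \<le> 1" "k / m < Suc k / m"
        using that m by (auto simp: m_def field_simps)
      have "\<exists>\<xi>\<in>{k / m<..<Suc k / m}. \<psi> (Suc k / m) - \<psi> (k / m) = (Suc k / m - k / m) * h \<xi>"
      proof -
        have "(\<psi> has_derivative (*) (h t)) (at t within {k / m..Suc k / m})"
          if "k / m \<le> t" "t \<le> Suc k / m" for t
          using has_derivative_subset[OF deriv[of t, unfolded has_field_derivative_def]] kI that by auto
        from mvt_simple[of "k / m" "Suc k / m" \<psi> "\<lambda>t. (*) (h t)", OF kI(3) this]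
        show ?thesis by (auto simp: mult.commute)
      qed
      then obtain \<xi> where \<xi>: "k / m < \<xi>" "\<xi> < Suc k / m" "\<psi> (Suc k / m) - \<psi> (k / m) = (Suc k / m - k / m) * h \<xi>"
        by auto
      have eq: "Suc k / m - k / m = 1 / m"
        by (simp add: diff_divide_distrib[symmetric])
      have "dist (h (k / m)) (h \<xi>) < r / 2"
      proof (rule \<delta>(2))
        show "dist (k / m) \<xi> < \<delta>" using \<xi> eq m\<delta> by (simp add: dist_real_def)
      qed (use \<xi> kI in auto)
      then have "\<bar>h (k / m) - h \<xi>\<bar> / m \<le> r / 2 / m"
        using m by (intro divide_right_mono) (auto simp: dist_real_def)
      moreover have "h (k / m) / m - (\<psi> (Suc k / m) - \<psi> (k / m)) = (h (k / m) - h \<xi>) / m"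
        unfolding \<xi>(3) eq by (simp add: diff_divide_distrib)
      ultimately show ?thesis
        using m by (simp add: abs_divide)
    qed
    have "(\<Sum>k<Suc n. \<psi> (Suc k / m) - \<psi> (k / m)) = \<psi> 1 - \<psi> 0"
      using sum_lessThan_telescope[of "\<lambda>k. \<psi> (k / m)" "Suc n"] by (simp add: m_def)
    then have "(\<Sum>k<Suc n. h (k / m)) / m - (\<psi> 1 - \<psi> 0) = (\<Sum>k<Suc n. h (k / m) / m - (\<psi> (Suc k / m) - \<psi> (k / m)))"
      by (simp only: sum_divide_distrib sum_subtractf)
    also have "\<bar>\<dots>\<bar> \<le> (\<Sum>k<Suc n. r / 2 / m)"
      using step by (intro order_trans[OF sum_abs] sum_mono) auto
    also have "\<dots> = r / 2"
      using m by (simp only: sum_constant card_lessThan m_def[symmetric]) simp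
    finally show ?thesis using r unfolding m_def by simp
  qed
  then show "\<exists>no. \<forall>n\<ge>no. norm ((\<Sum>k<Suc n. h (k / Suc n)) / Suc n - (\<psi> 1 - \<psi> 0)) < r"
    by blast
qed

section \<open>Random C1 fields: second moments of increments and the mean gradient\<close>

locale C1_random_field = prob_space +
  fixes S :: "'b::euclidean_space set" and F :: "'b \<Rightarrow> 'a \<Rightarrow> real" and g :: "'b \<Rightarrow> 'a \<Rightarrow> 'b" and V :: real
  assumes convex_S: "convex S"
    and F_integrable: "\<And>x. x \<in> S \<Longrightarrow> integrable M (F x)"
    and F_C1: "AE \<omega> in M. C1_with_gradient_on S (\<lambda>x. F x \<omega>) (\<lambda>x. g x \<omega>)"
    and g_meas: "\<And>x. x \<in> S \<Longrightarrow> g x \<in> borel_measurable M"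
    and g_sq_integrable: "\<And>x. x \<in> S \<Longrightarrow> integrable M (\<lambda>\<omega>. (norm (g x \<omega>))\<^sup>2)"
    and g_sq_bound: "\<And>x. x \<in> S \<Longrightarrow> expectation (\<lambda>\<omega>. (norm (g x \<omega>))\<^sup>2) \<le> V\<^sup>2"
begin

lemma segment_in_S:
  assumes "x \<in> S" "y \<in> S" "t \<in> {0..1}"
  shows "x + t *\<^sub>R (y - x) \<in> S"
proof -
  have "x + t *\<^sub>R (y - x) = (1 - t) *\<^sub>R x + t *\<^sub>R y"
    by (simp add: algebra_simps)
  then show ?thesis
    using convexD_alt[OF convex_S assms(1,2), of t] assms(3) by simp
qed

text \<open>Chain rule with derivatives relative to \<open>S\<close> and \<open>{0..1}\<close>: the
  segment stays in \<open>S\<close>, so boundary points and lower-dimensional sets are covered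
  without a separate case.\<close>

lemma C1_along_segment:
  assumes "C1_with_gradient_on S \<phi> G" "x \<in> S" "y \<in> S"
  shows "t \<in> {0..1} \<Longrightarrow> ((\<lambda>t. \<phi> (x + t *\<^sub>R (y - x))) has_real_derivative G (x + t *\<^sub>R (y - x)) \<bullet> (y - x)) (at t within {0..1})"
    and "continuous_on {0..1} (\<lambda>t. G (x + t *\<^sub>R (y - x)) \<bullet> (y - x))"
proof -
  have sub: "(\<lambda>t. x + t *\<^sub>R (y - x)) ` {0..1} \<subseteq> S"
    using segment_in_S[OF assms(2,3)] by auto
  show "((\<lambda>t. \<phi> (x + t *\<^sub>R (y - x))) has_real_derivative G (x + t *\<^sub>R (y - x)) \<bullet> (y - x)) (at t within {0..1})"
    if t: "t \<in> {0..1}"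
  proof -
    have "(\<phi> has_derivative (\<lambda>h. G (x + t *\<^sub>R (y - x)) \<bullet> h)) (at (x + t *\<^sub>R (y - x)) within (\<lambda>t. x + t *\<^sub>R (y - x)) ` {0..1})"
      using assms(1) segment_in_S[OF assms(2,3) t] sub
      unfolding C1_with_gradient_on_def by (blast intro: has_derivative_subset)
    moreover have "((\<lambda>t. x + t *\<^sub>R (y - x)) has_derivative (\<lambda>h. h *\<^sub>R (y - x))) (at t within {0..1})"
      by (auto intro!: derivative_eq_intros)
    ultimately have "((\<lambda>t. \<phi> (x + t *\<^sub>R (y - x))) has_derivative (\<lambda>h. G (x + t *\<^sub>R (y - x)) \<bullet> (h *\<^sub>R (y - x)))) (at t within {0..1})"
      by (rule has_derivative_in_compose[rotated])
    then show ?thesis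
      by (simp add: has_field_derivative_def mult_commute_abs)
  qed
  show "continuous_on {0..1} (\<lambda>t. G (x + t *\<^sub>R (y - x)) \<bullet> (y - x))"
  proof (rule continuous_on_inner[OF continuous_on_compose2[OF _ _ sub] continuous_on_const])
    show "continuous_on S G"
      using assms(1) by (simp add: C1_with_gradient_on_def)
  qed (intro continuous_intros)
qed

lemma gradient_inner_sq:
  assumes "x \<in> S"
  shows "integrable M (\<lambda>\<omega>. (g x \<omega> \<bullet> v)\<^sup>2)"
    and "expectation (\<lambda>\<omega>. (g x \<omega> \<bullet> v)\<^sup>2) \<le> V\<^sup>2 * (norm v)\<^sup>2"
proof -
  note [measurable] = g_meas[OF assms]
  have le: "(g x \<omega> \<bullet> v)\<^sup>2 \<le> (norm (g x \<omega>))\<^sup>2 * (norm v)\<^sup>2" for \<omega>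
    using Cauchy_Schwarz_ineq[of "g x \<omega>" v] by (simp add: power2_norm_eq_inner)
  have int: "integrable M (\<lambda>\<omega>. (norm (g x \<omega>))\<^sup>2 * (norm v)\<^sup>2)"
    using g_sq_integrable[OF assms] by simp
  show 1: "integrable M (\<lambda>\<omega>. (g x \<omega> \<bullet> v)\<^sup>2)"
    by (rule Bochner_Integration.integrable_bound[OF int]) (use le in auto)
  have "expectation (\<lambda>\<omega>. (g x \<omega> \<bullet> v)\<^sup>2) \<le> expectation (\<lambda>\<omega>. (norm (g x \<omega>))\<^sup>2 * (norm v)\<^sup>2)"
    using 1 int le by (intro integral_mono) auto
  also have "\<dots> \<le> V\<^sup>2 * (norm v)\<^sup>2"
    using g_sq_bound[OF assms] by (simp add: mult_right_mono)
  finally show "expectation (\<lambda>\<omega>. (g x \<omega> \<bullet> v)\<^sup>2) \<le> V\<^sup>2 * (norm v)\<^sup>2" .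
qed

text \<open>The increment is almost surely the limit of the averages \<open>R n\<close> of
  directional derivatives along the segment. The square of an average is at most the average of the
  squares, so each \<open>R n\<close> obeys the bound, and Fatou's lemma passes it to the
  limit.\<close>

lemma increment_sq:
  assumes x: "x \<in> S" and y: "y \<in> S"
  shows "integrable M (\<lambda>\<omega>. (F y \<omega> - F x \<omega>)\<^sup>2)"
    and "expectation (\<lambda>\<omega>. (F y \<omega> - F x \<omega>)\<^sup>2) \<le> V\<^sup>2 * (norm (y - x))\<^sup>2"
proof -
  define z where "z n k = x + (real k / Suc n) *\<^sub>R (y - x)" for n k :: nat
  have z: "z n k \<in> S" if "k < Suc n" for n k
    unfolding z_def using that by (intro segment_in_S x y) (simp add: field_simps)
  define R where "R n \<omega> = (\<Sum>k<Suc n. g (z n k) \<omega> \<bullet> (y - x)) / Suc n" for n \<omega>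
  have [measurable]: "R n \<in> borel_measurable M" for n
    unfolding R_def using g_meas[OF z] by (intro borel_measurable_divide borel_measurable_sum borel_measurable_inner) auto
  have [measurable]: "F x \<in> borel_measurable M" "F y \<in> borel_measurable M"
    using F_integrable x y by blast+
  have lim: "AE \<omega> in M. (\<lambda>n. R n \<omega>) \<longlonglongrightarrow> F y \<omega> - F x \<omega>"
    using F_C1
  proof eventually_elim
    case (elim \<omega>)
    from Riemann_sums_tendsto[OF C1_along_segment[OF this x y]] show ?case
      by (simp add: R_def z_def del: of_nat_Suc sum.lessThan_Suc)
  qed
  have R_bound: "(\<integral>\<^sup>+\<omega>. ennreal ((R n \<omega>)\<^sup>2) \<partial>M) \<le> ennreal (V\<^sup>2 * (norm (y - x))\<^sup>2)" for n
  proof -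
    let ?Q = "\<lambda>\<omega>. (\<Sum>k<Suc n. (g (z n k) \<omega> \<bullet> (y - x))\<^sup>2) / Suc n"
    have intQ: "integrable M ?Q"
      using gradient_inner_sq(1)[OF z] by (intro integrable_divide Bochner_Integration.integrable_sum) auto
    have "(R n \<omega>)\<^sup>2 \<le> ?Q \<omega>" for \<omega>
    proof -
      have "(\<Sum>k<Suc n. g (z n k) \<omega> \<bullet> (y - x))\<^sup>2 \<le> (\<Sum>k<Suc n. (g (z n k) \<omega> \<bullet> (y - x))\<^sup>2) * card {..<Suc n}"
        by (rule sum_squared_le_sum_of_squares)
      then have "(R n \<omega>)\<^sup>2 \<le> (\<Sum>k<Suc n. (g (z n k) \<omega> \<bullet> (y - x))\<^sup>2) * Suc n / (real (Suc n))\<^sup>2"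
        unfolding R_def power_divide by (intro divide_right_mono) auto
      also have "\<dots> = ?Q \<omega>" by (simp add: power2_eq_square del: sum.lessThan_Suc)
      finally show ?thesis .
    qed
    then have "(\<integral>\<^sup>+\<omega>. ennreal ((R n \<omega>)\<^sup>2) \<partial>M) \<le> (\<integral>\<^sup>+\<omega>. ennreal (?Q \<omega>) \<partial>M)"
      by (intro nn_integral_mono ennreal_leI)
    also have "\<dots> = ennreal (expectation ?Q)"
      using intQ by (intro nn_integral_eq_integral) (auto intro!: divide_nonneg_nonneg sum_nonneg simp del: sum.lessThan_Suc)
    also have "\<dots> \<le> ennreal (V\<^sup>2 * (norm (y - x))\<^sup>2)"
    proof (rule ennreal_leI)
      have "expectation ?Q = (\<Sum>k<Suc n. expectation (\<lambda>\<omega>. (g (z n k) \<omega> \<bullet> (y - x))\<^sup>2)) / Suc n"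
        using gradient_inner_sq(1)[OF z] by (simp del: sum.lessThan_Suc of_nat_Suc)
      also have "\<dots> \<le> (\<Sum>k<Suc n. V\<^sup>2 * (norm (y - x))\<^sup>2) / Suc n"
        using gradient_inner_sq(2)[OF z] by (intro divide_right_mono sum_mono) auto
      also have "\<dots> = V\<^sup>2 * (norm (y - x))\<^sup>2"
        by (simp del: sum.lessThan_Suc of_nat_Suc)
      finally show "expectation ?Q \<le> V\<^sup>2 * (norm (y - x))\<^sup>2" .
    qed
    finally show ?thesis .
  qed
  have "(\<integral>\<^sup>+\<omega>. ennreal ((F y \<omega> - F x \<omega>)\<^sup>2) \<partial>M) = (\<integral>\<^sup>+\<omega>. liminf (\<lambda>n. ennreal ((R n \<omega>)\<^sup>2)) \<partial>M)"
  proof (rule nn_integral_cong_AE)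
    show "AE \<omega> in M. ennreal ((F y \<omega> - F x \<omega>)\<^sup>2) = liminf (\<lambda>n. ennreal ((R n \<omega>)\<^sup>2))"
      using lim
    proof eventually_elim
      case (elim \<omega>)
      then have "(\<lambda>n. ennreal ((R n \<omega>)\<^sup>2)) \<longlonglongrightarrow> ennreal ((F y \<omega> - F x \<omega>)\<^sup>2)"
        by (intro tendsto_ennrealI tendsto_power)
      then show ?case
        by (rule lim_imp_Liminf[OF sequentially_bot, symmetric])
    qed
  qed
  also have "\<dots> \<le> liminf (\<lambda>n. \<integral>\<^sup>+\<omega>. ennreal ((R n \<omega>)\<^sup>2) \<partial>M)"
    by (rule nn_integral_liminf) measurable
  also have "\<dots> \<le> ennreal (V\<^sup>2 * (norm (y - x))\<^sup>2)"
    using Liminf_mono[OF always_eventually, of "\<lambda>n. \<integral>\<^sup>+\<omega>. ennreal ((R n \<omega>)\<^sup>2) \<partial>M" "\<lambda>n. ennreal (V\<^sup>2 * (norm (y - x))\<^sup>2)" sequentially] R_bound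
    by (simp add: Liminf_const)
  finally have le: "(\<integral>\<^sup>+\<omega>. ennreal ((F y \<omega> - F x \<omega>)\<^sup>2) \<partial>M) \<le> ennreal (V\<^sup>2 * (norm (y - x))\<^sup>2)" .
  show int: "integrable M (\<lambda>\<omega>. (F y \<omega> - F x \<omega>)\<^sup>2)"
    by (rule integrableI_nonneg) (use le in \<open>auto simp: le_less_trans ennreal_less_top\<close>)
  have eq: "ennreal (expectation (\<lambda>\<omega>. (F y \<omega> - F x \<omega>)\<^sup>2)) = (\<integral>\<^sup>+\<omega>. ennreal ((F y \<omega> - F x \<omega>)\<^sup>2) \<partial>M)"
    by (rule nn_integral_eq_integral[OF int, symmetric]) auto
  show "expectation (\<lambda>\<omega>. (F y \<omega> - F x \<omega>)\<^sup>2) \<le> V\<^sup>2 * (norm (y - x))\<^sup>2"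
    using le unfolding eq[symmetric] by (simp add: ennreal_le_iff)
qed

text \<open>The difference quotients \<open>D n\<close> from \<open>x\<close> towards
  \<open>y\<close> have mean exactly \<open>c \<bullet> (y - x)\<close> by affinity. The increment
  bound is quadratic in the step length, so it cancels the factor
  \<open>(real (Suc n))\<^sup>2\<close> and leaves an L2 bound uniform in \<open>n\<close>; this
  lets the almost sure limit be taken under the expectation.\<close>

lemma expectation_gradient_inner:
  assumes affine: "\<And>z. z \<in> S \<Longrightarrow> expectation (F z) = c \<bullet> z + b"
    and x: "x \<in> S" and y: "y \<in> S"
  shows "expectation (\<lambda>\<omega>. g x \<omega> \<bullet> (y - x)) = c \<bullet> (y - x)"
proof -
  note [measurable] = g_meas[OF x]
  define z where "z n = x + (1 / Suc n) *\<^sub>R (y - x)" for n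
  have z: "z n \<in> S" for n
    unfolding z_def by (intro segment_in_S x y) auto
  define D where "D n \<omega> = (F (z n) \<omega> - F x \<omega>) * Suc n" for n \<omega>
  have meas: "D n \<in> borel_measurable M" for n
    unfolding D_def using F_integrable[OF z] F_integrable[OF x] by simp
  have Dsq: "(D n \<omega>)\<^sup>2 = (F (z n) \<omega> - F x \<omega>)\<^sup>2 * (real (Suc n))\<^sup>2" for n \<omega>
    by (simp add: D_def power_mult_distrib)
  have "(\<lambda>n. expectation (D n)) \<longlonglongrightarrow> expectation (\<lambda>\<omega>. g x \<omega> \<bullet> (y - x))"
  proof (rule tendsto_expectation_L2_bounded)
    show "integrable M (\<lambda>\<omega>. (D n \<omega>)\<^sup>2)" for n
      unfolding Dsq using increment_sq(1)[OF x z] by simp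
    have "norm (z n - x) = norm (y - x) / Suc n" for n
      by (simp add: z_def del: of_nat_Suc)
    then show "expectation (\<lambda>\<omega>. (D n \<omega>)\<^sup>2) \<le> V\<^sup>2 * (norm (y - x))\<^sup>2" for n
      unfolding Dsq using increment_sq(2)[OF x z, of n]
      by (simp add: power_divide pos_le_divide_eq del: of_nat_Suc)
    show "AE \<omega> in M. (\<lambda>n. D n \<omega>) \<longlonglongrightarrow> g x \<omega> \<bullet> (y - x)"
      using F_C1
    proof eventually_elim
      case (elim \<omega>)
      have "filterlim (\<lambda>n. 1 / real (Suc n)) (at 0 within {0..1}) sequentially"
        unfolding filterlim_at using LIMSEQ_inverse_real_of_nat
        by (auto simp: inverse_eq_divide intro!: always_eventually)
      moreover have "((\<lambda>t. (F (x + t *\<^sub>R (y - x)) \<omega> - F x \<omega>) / t) \<longlongrightarrow> g x \<omega> \<bullet> (y - x)) (at 0 within {0..1})"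
        using C1_along_segment(1)[OF elim x y, of 0] by (simp add: has_field_derivative_iff)
      ultimately have "(\<lambda>n. (F (x + (1 / real (Suc n)) *\<^sub>R (y - x)) \<omega> - F x \<omega>) / (1 / real (Suc n))) \<longlonglongrightarrow> g x \<omega> \<bullet> (y - x)"
        by (rule filterlim_compose[rotated])
      then show ?case
        by (simp add: D_def z_def del: of_nat_Suc)
    qed
  qed (use meas gradient_inner_sq[OF x] in auto)
  moreover have "expectation (D n) = c \<bullet> (y - x)" for n
  proof -
    have "expectation (D n) = (expectation (F (z n)) - expectation (F x)) * Suc n"
      unfolding D_def using F_integrable[OF z] F_integrable[OF x] by (simp del: of_nat_Suc)
    also have "\<dots> = c \<bullet> (y - x)"
      unfolding affine[OF x] affine[OF z] by (simp add: z_def inner_add_right inner_diff_right del: of_nat_Suc)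
    finally show ?thesis .
  qed
  ultimately show ?thesis
    by (simp add: LIMSEQ_const_iff)
qed

text \<open>The vector \<open>y' - y\<close> need not be a feasible direction at \<open>x\<close>,
  but it is the difference of the feasible directions \<open>y' - x\<close> and
  \<open>y - x\<close>. This form is needed because the gradient is taken at the current iterate
  while the direction joins the solution to another point.\<close>

lemma expectation_gradient_inner':
  assumes affine: "\<And>z. z \<in> S \<Longrightarrow> expectation (F z) = c \<bullet> z + b"
    and S: "x \<in> S" "y \<in> S" "y' \<in> S"
  shows "expectation (\<lambda>\<omega>. g x \<omega> \<bullet> (y' - y)) = c \<bullet> (y' - y)"
proof -
  have "integrable M (\<lambda>\<omega>. g x \<omega> \<bullet> v)" for v
    by (rule square_integrable_imp_integrable[OF _ gradient_inner_sq(1)[OF S(1)]]) (use g_meas[OF S(1)] in simp)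
  moreover have "(\<lambda>\<omega>. g x \<omega> \<bullet> (y' - y)) = (\<lambda>\<omega>. g x \<omega> \<bullet> (y' - x) - g x \<omega> \<bullet> (y - x))"
    by (auto simp: inner_diff_right)
  ultimately show ?thesis
    using expectation_gradient_inner[OF affine S(1) S(2)] expectation_gradient_inner[OF affine S(1) S(3)]
    by (simp add: inner_diff_right)
qed

end

section \<open>Independence of the current state from the next sample\<close>

text \<open>
  Independence is expressed by a product law, since \<open>indep_var\<close> requires both variables to take
  values in the same type.
\<close>
lemma (in prob_space) recursive_state_independent:
  assumes ind: "indep_vars (\<lambda>_. N) W UNIV"
    and init: "\<And>s. s \<in> space M \<Longrightarrow> Z 0 s = z0" "z0 \<in> space Q"
    and step: "\<And>n s. s \<in> space M \<Longrightarrow> Z (Suc n) s = \<Phi> n (Z n s, W n s)"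
    and meas: "\<And>n. \<Phi> n \<in> measurable (Q \<Otimes>\<^sub>M N) Q"
  shows "Z n \<in> measurable M Q"
    and "distr M (Q \<Otimes>\<^sub>M N) (\<lambda>s. (Z n s, W (n :: nat) s)) = distr M Q (Z n) \<Otimes>\<^sub>M distr M N (W n)"
proof -
  \<comment> \<open>The state at time \<open>n\<close> has consumed exactly the samples with index
    below \<open>n\<close>, so \<open>W n\<close> is still fresh.\<close>
  have "\<exists>\<phi> \<in> measurable (PiM {..<n} (\<lambda>_. N)) Q. \<forall>s\<in>space M. Z n s = \<phi> (\<lambda>i\<in>{..<n}. W i s)"
  proof (induction n)
    case 0
    then show ?case using init by (intro bexI[of _ "\<lambda>_. z0"]) auto
  next
    case (Suc n)
    then obtain \<phi> where \<phi> [measurable]: "\<phi> \<in> measurable (PiM {..<n} (\<lambda>_. N)) Q"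
      and Z: "\<And>s. s \<in> space M \<Longrightarrow> Z n s = \<phi> (\<lambda>i\<in>{..<n}. W i s)" by blast
    let ?\<psi> = "\<lambda>w. \<Phi> n (\<phi> (restrict w {..<n}), w n)"
    have "(\<lambda>w. restrict w {..<n}) \<in> measurable (PiM {..<Suc n} (\<lambda>_. N)) (PiM {..<n} (\<lambda>_. N))"
      by (rule measurable_restrict_subset) auto
    then have \<psi>: "?\<psi> \<in> measurable (PiM {..<Suc n} (\<lambda>_. N)) Q"
      by (intro measurable_compose[OF _ meas] measurable_Pair measurable_compose[OF _ \<phi>] measurable_component_singleton) auto
    have Z\<psi>: "\<forall>s\<in>space M. Z (Suc n) s = ?\<psi> (\<lambda>i\<in>{..<Suc n}. W i s)"
    proof
      fix s assume that: "s \<in> space M"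
      have "restrict (\<lambda>i\<in>{..<Suc n}. W i s) {..<n} = (\<lambda>i\<in>{..<n}. W i s)"
        by (auto simp: restrict_def)
      then show "Z (Suc n) s = ?\<psi> (\<lambda>i\<in>{..<Suc n}. W i s)"
        using that by (simp add: step Z)
    qed
    show ?case by (rule bexI[of _ ?\<psi>]) (rule Z\<psi>, rule \<psi>)
  qed
  then obtain \<phi> where \<phi>: "\<phi> \<in> measurable (PiM {..<n} (\<lambda>_. N)) Q"
    and Z: "\<And>s. s \<in> space M \<Longrightarrow> Z n s = \<phi> (\<lambda>i\<in>{..<n}. W i s)" by blast
  have W: "W i \<in> measurable M N" for i
    using ind by (auto simp: indep_vars_def)
  \<comment> \<open>The single sample is read as a block over \<open>{n}\<close>, disjoint from
    \<open>{..<n}\<close>. Independence of the two blocks gives a product law, which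
    \<open>\<phi>\<close> and evaluation at \<open>n\<close> push forward to \<open>Z n\<close> and
    \<open>W n\<close>.\<close>
  let ?A = "PiM {..<n} (\<lambda>_. N)" and ?B = "PiM {n} (\<lambda>_. N)"
  let ?U = "\<lambda>s. \<lambda>i\<in>{..<n}. W i s" and ?V = "\<lambda>s. \<lambda>i\<in>{n}. W i s"
  have U: "?U \<in> measurable M ?A" and V: "?V \<in> measurable M ?B"
    using W by (auto intro!: measurable_restrict)
  have UV: "(\<lambda>s. (?U s, ?V s)) \<in> measurable M (?A \<Otimes>\<^sub>M ?B)"
    using U V by (rule measurable_Pair)
  have e: "(\<lambda>w. w n) \<in> measurable ?B N"
    by (rule measurable_component_singleton) simp
  have "(\<lambda>s. \<phi> (?U s)) \<in> measurable M Q"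
    by (rule measurable_compose[OF U \<phi>])
  then show Z_meas: "Z n \<in> measurable M Q"
    using Z by (simp cong: measurable_cong)
  have "indep_var ?A ?U ?B ?V"
    by (rule indep_var_restrict[OF ind]) auto
  then have eq: "distr M (?A \<Otimes>\<^sub>M ?B) (\<lambda>s. (?U s, ?V s)) = distr M ?A ?U \<Otimes>\<^sub>M distr M ?B ?V"
    by (simp only: indep_var_distribution_eq)
  have U': "distr (distr M ?A ?U) Q \<phi> = distr M Q (Z n)"
    using Z by (subst distr_distr[OF \<phi> U]) (auto intro!: distr_cong)
  have V': "distr (distr M ?B ?V) N (\<lambda>w. w n) = distr M N (W n)"
    by (subst distr_distr[OF e V]) (auto intro!: distr_cong)
  have "distr M Q (Z n) \<Otimes>\<^sub>M distr M N (W n) = distr (distr M ?A ?U) Q \<phi> \<Otimes>\<^sub>M distr (distr M ?B ?V) N (\<lambda>w. w n)"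
    by (simp only: U' V')
  also have "\<dots> = distr (distr M ?A ?U \<Otimes>\<^sub>M distr M ?B ?V) (Q \<Otimes>\<^sub>M N) (\<lambda>(x, y). (\<phi> x, y n))"
  proof (rule pair_measure_distr)
    have "prob_space (distr M N (W n))"
      using W by (rule prob_space_distr)
    then show "sigma_finite_measure (distr (distr M ?B ?V) N (\<lambda>w. w n))"
      unfolding V' by (rule prob_space_imp_sigma_finite)
  qed (use \<phi> e in \<open>auto simp: measurable_distr_eq1\<close>)
  also have "\<dots> = distr M (Q \<Otimes>\<^sub>M N) (\<lambda>s. (\<phi> (?U s), ?V s n))"
    unfolding eq[symmetric] using \<phi> e UV by (subst distr_distr) (auto simp: comp_def case_prod_beta')
  also have "\<dots> = distr M (Q \<Otimes>\<^sub>M N) (\<lambda>s. (Z n s, W n s))"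
    using Z by (auto intro!: distr_cong)
  finally show "distr M (Q \<Otimes>\<^sub>M N) (\<lambda>s. (Z n s, W n s)) = distr M Q (Z n) \<Otimes>\<^sub>M distr M N (W n)" ..
qed

text \<open>Fubini for the product law: with the state frozen the inner integral vanishes. This
  replaces conditional expectations in expressing the martingale difference property.\<close>

lemma (in prob_space) expectation_indep_eq_0:
  fixes k :: "'q \<times> 'w \<Rightarrow> real"
  assumes U [measurable]: "U \<in> measurable M Q" and W [measurable]: "W \<in> measurable M N"
    and D: "distr M (Q \<Otimes>\<^sub>M N) (\<lambda>s. (U s, W s)) = distr M Q U \<Otimes>\<^sub>M distr M N W"
    and k [measurable]: "k \<in> borel_measurable (Q \<Otimes>\<^sub>M N)"
    and int: "integrable M (\<lambda>s. k (U s, W s))"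
    and zero: "\<And>u. u \<in> space Q \<Longrightarrow> (\<integral>w. k (u, w) \<partial>distr M N W) = 0"
  shows "expectation (\<lambda>s. k (U s, W s)) = 0"
proof -
  interpret D1: prob_space "distr M Q U" by (rule prob_space_distr) measurable
  interpret D2: prob_space "distr M N W" by (rule prob_space_distr) measurable
  interpret D: pair_prob_space "distr M Q U" "distr M N W" ..
  have "integrable (distr M (Q \<Otimes>\<^sub>M N) (\<lambda>s. (U s, W s))) k"
    using int by (subst integrable_distr_eq) simp_all
  then have int': "integrable (distr M Q U \<Otimes>\<^sub>M distr M N W) k"
    by (simp only: D)
  have "expectation (\<lambda>s. k (U s, W s)) = integral\<^sup>L (distr M (Q \<Otimes>\<^sub>M N) (\<lambda>s. (U s, W s))) k"
    by (subst integral_distr) simp_all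
  also have "\<dots> = (\<integral>u. (\<integral>w. k (u, w) \<partial>distr M N W) \<partial>distr M Q U)"
    unfolding D by (rule D.integral_fst'[OF int', symmetric])
  also have "\<dots> = (\<integral>u. 0 \<partial>distr M Q U)"
    using zero by (intro Bochner_Integration.integral_cong) auto
  finally show ?thesis by simp
qed

text \<open>The Tonelli counterpart; being free of integrability assumptions, it serves to prove
  that the squared noise along the trajectory is integrable.\<close>

lemma (in prob_space) nn_integral_indep_le:
  assumes U [measurable]: "U \<in> measurable M Q" and W [measurable]: "W \<in> measurable M N"
    and D: "distr M (Q \<Otimes>\<^sub>M N) (\<lambda>s. (U s, W s)) = distr M Q U \<Otimes>\<^sub>M distr M N W"
    and k [measurable]: "k \<in> borel_measurable (Q \<Otimes>\<^sub>M N)"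
    and le: "\<And>u. u \<in> space Q \<Longrightarrow> (\<integral>\<^sup>+w. k (u, w) \<partial>distr M N W) \<le> C"
  shows "(\<integral>\<^sup>+s. k (U s, W s) \<partial>M) \<le> C"
proof -
  interpret D1: prob_space "distr M Q U" by (rule prob_space_distr) measurable
  interpret D2: prob_space "distr M N W" by (rule prob_space_distr) measurable
  interpret D: pair_prob_space "distr M Q U" "distr M N W" ..
  have "(\<integral>\<^sup>+s. k (U s, W s) \<partial>M) = integral\<^sup>N (distr M (Q \<Otimes>\<^sub>M N) (\<lambda>s. (U s, W s))) k"
    by (subst nn_integral_distr) simp_all
  also have "\<dots> = (\<integral>\<^sup>+u. (\<integral>\<^sup>+w. k (u, w) \<partial>distr M N W) \<partial>distr M Q U)"
    unfolding D by (rule D2.nn_integral_fst[symmetric]) simp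
  also have "\<dots> \<le> (\<integral>\<^sup>+u. C \<partial>distr M Q U)"
    using le by (intro nn_integral_mono) auto
  finally show ?thesis using D1.emeasure_space_1 by simp
qed

section \<open>Almost sure boundedness of the accumulated noise\<close>

text \<open>
  Freezing the sum once it exceeds \<open>K\<close> in absolute value makes a second-moment bound at the final
  time do the work of a maximal inequality: a path that ever exceeds \<open>K\<close> stays above it.
\<close>
primrec stopped_sum :: "real \<Rightarrow> (nat \<Rightarrow> real) \<Rightarrow> nat \<Rightarrow> real" where
  "stopped_sum K x 0 = 0"
| "stopped_sum K x (Suc n) = (if \<bar>stopped_sum K x n\<bar> \<le> K then stopped_sum K x n + x n else stopped_sum K x n)"

lemma stopped_sum_eq_sum:
  assumes "\<And>n. \<bar>stopped_sum K x n\<bar> \<le> K"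
  shows "stopped_sum K x n = (\<Sum>i<n. x i)"
proof (induction n)
  case (Suc n)
  then show ?case using assms[of n] by simp
qed simp

text \<open>The increments of the stopped sum are orthogonal to its past, so its second moment stays
  below \<open>C * G\<close> at all times. Markov's inequality bounds the probability of ever
  exceeding \<open>K\<close> by \<open>C * G / K\<^sup>2\<close>, which tends to 0 as
  \<open>K\<close> grows.\<close>

lemma (in prob_space) AE_bounded_noise_sum:
  fixes h :: "'q \<times> 'w \<Rightarrow> real" and \<gamma> :: "nat \<Rightarrow> real"
  assumes ind: "indep_vars (\<lambda>_. N) W UNIV" and dist: "\<And>n. distr M N (W n) = N"
    and init: "\<And>s. s \<in> space M \<Longrightarrow> Z 0 s = z0" "z0 \<in> space Q"
    and step: "\<And>n s. s \<in> space M \<Longrightarrow> Z (Suc n) s = \<Phi> n (Z n s, W n s)"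
    and meas: "\<And>n. \<Phi> n \<in> measurable (Q \<Otimes>\<^sub>M N) Q"
    and h [measurable]: "h \<in> borel_measurable (Q \<Otimes>\<^sub>M N)"
    and h_zero: "\<And>z. z \<in> space Q \<Longrightarrow> (\<integral>w. h (z, w) \<partial>N) = 0"
    and h_sq: "\<And>z. z \<in> space Q \<Longrightarrow> (\<integral>\<^sup>+w. ennreal ((h (z, w))\<^sup>2) \<partial>N) \<le> ennreal C"
    and C: "C \<ge> 0"
    and \<gamma>: "summable (\<lambda>n. (\<gamma> n)\<^sup>2)"
  shows "AE s in M. \<exists>B. \<forall>n. \<bar>\<Sum>i<n. \<gamma> i * h (Z i s, W i s)\<bar> \<le> B"
proof -
  define G where "G = (\<Sum>n. (\<gamma> n)\<^sup>2)"
  have W [measurable]: "W n \<in> measurable M N" for n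
    using ind by (auto simp: indep_vars_def)
  have Z [measurable]: "Z n \<in> measurable M Q" for n
    using ind init step meas by (rule recursive_state_independent(1))
  define x where "x s n = \<gamma> n * h (Z n s, W n s)" for s n
  define T where "T K n s = stopped_sum K (x s) n" for K n s
  have T0: "T K 0 s = 0" and TSuc: "T K (Suc n) s = (if \<bar>T K n s\<bar> \<le> K then T K n s + \<gamma> n * h (Z n s, W n s) else T K n s)" for K n s
    by (simp_all add: T_def x_def)
  have T_meas [measurable]: "T K n \<in> borel_measurable M" for K n
  proof (induction n)
    case 0
    then show ?case by (simp add: T0[abs_def])
  next
    case (Suc n)
    note [measurable] = this
    show ?case unfolding TSuc[abs_def] by measurable
  qed
  \<comment> \<open>The pair of state and stopped sum is itself a recursion driven by the same
    samples, so \<open>W n\<close> is independent of both components jointly.\<close>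
  have indT: "(\<lambda>s. (Z n s, T K n s)) \<in> measurable M (Q \<Otimes>\<^sub>M borel)"
    "distr M ((Q \<Otimes>\<^sub>M borel) \<Otimes>\<^sub>M N) (\<lambda>s. ((Z n s, T K n s), W n s)) =
      distr M (Q \<Otimes>\<^sub>M borel) (\<lambda>s. (Z n s, T K n s)) \<Otimes>\<^sub>M distr M N (W n)" for n K
  proof -
    let ?\<Psi> = "\<lambda>n p. (\<Phi> n (fst (fst p), snd p),
      if \<bar>snd (fst p)\<bar> \<le> K then snd (fst p) + \<gamma> n * h (fst (fst p), snd p) else snd (fst p))"
    have 1: "(Z 0 s, T K 0 s) = (z0, 0)" if "s \<in> space M" for s
      using that by (simp add: init T0)
    have 2: "(z0, 0) \<in> space (Q \<Otimes>\<^sub>M borel)"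
      using init by (simp add: space_pair_measure)
    have 3: "(Z (Suc n) s, T K (Suc n) s) = ?\<Psi> n ((Z n s, T K n s), W n s)" if "s \<in> space M" for s n
      using that by (simp add: step TSuc)
    have 4: "?\<Psi> n \<in> measurable ((Q \<Otimes>\<^sub>M borel) \<Otimes>\<^sub>M N) (Q \<Otimes>\<^sub>M borel)" for n
      using meas[measurable] by measurable
    show "(\<lambda>s. (Z n s, T K n s)) \<in> measurable M (Q \<Otimes>\<^sub>M borel)" by measurable
    show "distr M ((Q \<Otimes>\<^sub>M borel) \<Otimes>\<^sub>M N) (\<lambda>s. ((Z n s, T K n s), W n s)) =
      distr M (Q \<Otimes>\<^sub>M borel) (\<lambda>s. (Z n s, T K n s)) \<Otimes>\<^sub>M distr M N (W n)"
      by (rule recursive_state_independent(2)[where Z = "\<lambda>n s. (Z n s, T K n s)" and \<Phi> = ?\<Psi>, OF ind 1 2 3 4])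
  qed
  have hsq: "integrable M (\<lambda>s. (h (Z n s, W n s))\<^sup>2)" "expectation (\<lambda>s. (h (Z n s, W n s))\<^sup>2) \<le> C" for n
  proof -
    have le: "(\<integral>\<^sup>+s. ennreal ((h (Z n s, W n s))\<^sup>2) \<partial>M) \<le> ennreal C"
      using nn_integral_indep_le[OF Z W recursive_state_independent(2)[OF ind init step meas], of "\<lambda>p. ennreal ((h p)\<^sup>2)" n "ennreal C"] h_sq dist
      by simp
    show int: "integrable M (\<lambda>s. (h (Z n s, W n s))\<^sup>2)"
      by (rule integrableI_nonneg) (use le in \<open>auto simp: le_less_trans ennreal_less_top\<close>)
    have eq: "ennreal (expectation (\<lambda>s. (h (Z n s, W n s))\<^sup>2)) = (\<integral>\<^sup>+s. ennreal ((h (Z n s, W n s))\<^sup>2) \<partial>M)"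
      by (rule nn_integral_eq_integral[OF int, symmetric]) auto
    show "expectation (\<lambda>s. (h (Z n s, W n s))\<^sup>2) \<le> C"
      using le C unfolding eq[symmetric] by (simp add: ennreal_le_iff)
  qed
  have h_int: "integrable M (\<lambda>s. h (Z n s, W n s))" for n
    by (rule square_integrable_imp_integrable[OF _ hsq(1)]) measurable
  have Tsq: "integrable M (\<lambda>s. (T K n s)\<^sup>2) \<and> expectation (\<lambda>s. (T K n s)\<^sup>2) \<le> C * (\<Sum>i<n. (\<gamma> i)\<^sup>2)" if "K > 0" for K n
  proof (induction n)
    case 0
    then show ?case by (simp add: T0)
  next
    case (Suc n)
    \<comment> \<open>\<open>c\<close> and \<open>q\<close> are the cross term and the quadratic
      term in the expansion of the next square, both set to 0 once the sum is frozen. Where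
      \<open>c\<close> is nonzero the stopped sum is at most \<open>K\<close> in absolute value, so
      \<open>c\<close> is dominated by a multiple of the integrable noise.\<close>
    define c where "c s = (if \<bar>T K n s\<bar> \<le> K then T K n s * h (Z n s, W n s) else 0)" for s
    define q where "q s = (if \<bar>T K n s\<bar> \<le> K then (h (Z n s, W n s))\<^sup>2 else 0)" for s
    have [measurable]: "c \<in> borel_measurable M" "q \<in> borel_measurable M"
      unfolding c_def q_def by measurable
    have c_int: "integrable M c"
      by (rule Bochner_Integration.integrable_bound[OF integrable_mult_right[OF h_int[of n], of K]])
        (use that in \<open>auto simp: c_def abs_mult mult_right_mono\<close>)
    have q_int: "integrable M q"
      by (rule Bochner_Integration.integrable_bound[OF hsq(1)[of n]]) (auto simp: q_def)
    have "expectation q \<le> expectation (\<lambda>s. (h (Z n s, W n s))\<^sup>2)"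
      by (rule integral_mono[OF q_int hsq(1)]) (simp add: q_def)
    then have Eq: "expectation q \<le> C"
      using hsq(2)[of n] by linarith
    have Ec: "expectation c = 0"
    proof -
      let ?k = "\<lambda>p. if \<bar>snd (fst p)\<bar> \<le> K then snd (fst p) * h (fst (fst p), snd p) else 0"
      have "expectation (\<lambda>s. ?k ((Z n s, T K n s), W n s)) = 0"
      proof (rule expectation_indep_eq_0[OF indT(1) W indT(2)])
        show "integrable M (\<lambda>s. ?k ((Z n s, T K n s), W n s))"
          using c_int by (simp add: c_def[abs_def] cong: if_cong)
        show "(\<integral>w. ?k (u, w) \<partial>distr M N (W n)) = 0" if "u \<in> space (Q \<Otimes>\<^sub>M borel)" for u
          using that h_zero[of "fst u"] by (cases "\<bar>snd u\<bar> \<le> K") (auto simp: dist space_pair_measure)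
      qed measurable
      then show ?thesis by (simp add: c_def[abs_def] cong: if_cong)
    qed
    have eq: "(T K (Suc n) s)\<^sup>2 = (T K n s)\<^sup>2 + 2 * \<gamma> n * c s + (\<gamma> n)\<^sup>2 * q s" for s
      by (auto simp: TSuc c_def q_def power2_eq_square algebra_simps)
    have "expectation (\<lambda>s. (T K (Suc n) s)\<^sup>2) = expectation (\<lambda>s. (T K n s)\<^sup>2) + (\<gamma> n)\<^sup>2 * expectation q"
      unfolding eq using Suc c_int q_int Ec by simp
    also have "\<dots> \<le> C * (\<Sum>i<n. (\<gamma> i)\<^sup>2) + (\<gamma> n)\<^sup>2 * C"
      using Suc Eq by (intro add_mono mult_left_mono) auto
    finally show ?case
      unfolding eq using Suc c_int q_int by (simp add: algebra_simps)
  qed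
  define E where "E K n = {s \<in> space M. \<bar>T K n s\<bar> > K}" for K n
  have [measurable]: "E K n \<in> sets M" for K n
    unfolding E_def by measurable
  have prob_E: "prob (E K n) \<le> C * G / K\<^sup>2" if K: "K > 0" for K n
  proof -
    have "prob (E K n) \<le> prob {s \<in> space M. (T K n s)\<^sup>2 \<ge> K\<^sup>2}"
    proof (rule finite_measure_mono)
      show "E K n \<subseteq> {s \<in> space M. (T K n s)\<^sup>2 \<ge> K\<^sup>2}"
        using K by (auto simp: E_def abs_le_square_iff[symmetric])
    qed measurable
    also have "\<dots> \<le> expectation (\<lambda>s. (T K n s)\<^sup>2) / K\<^sup>2"
      using Tsq[OF K, of n] K by (intro integral_Markov_inequality_measure[where A = "{}"]) auto
    also have "\<dots> \<le> C * G / K\<^sup>2"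
    proof (rule divide_right_mono)
      have "(\<Sum>i<n. (\<gamma> i)\<^sup>2) \<le> G"
        unfolding G_def using \<gamma> by (intro sum_le_suminf) auto
      then have "C * (\<Sum>i<n. (\<gamma> i)\<^sup>2) \<le> C * G"
        using C by (rule mult_left_mono)
      with Tsq[OF K, of n] show "expectation (\<lambda>s. (T K n s)\<^sup>2) \<le> C * G" by linarith
    qed simp
    finally show ?thesis .
  qed
  have prob_UN: "prob (\<Union>n. E K n) \<le> C * G / K\<^sup>2" if K: "K > 0" for K
  proof (rule LIMSEQ_le_const2)
    \<comment> \<open>A frozen path keeps its value above \<open>K\<close>, so the events grow with
      \<open>n\<close> and continuity from below carries the uniform bound to their union.\<close>
    have "incseq (E K)"
      by (rule incseq_SucI) (auto simp: E_def TSuc)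
    then show "(\<lambda>n. prob (E K n)) \<longlonglongrightarrow> prob (\<Union>n. E K n)"
      by (intro finite_Lim_measure_incseq) auto
  qed (use prob_E[OF K] in blast)
  \<comment> \<open>Outcomes for which the sum is frozen at every threshold; \<open>Suc m\<close>
    gives countably many positive thresholds tending to infinity. Off this set some threshold is
    never crossed, and there the stopped sum is the plain sum.\<close>
  define Bad where "Bad = (\<Inter>m. \<Union>n. E (real (Suc m)) n)"
  have [measurable]: "Bad \<in> sets M"
    unfolding Bad_def by measurable
  have "prob Bad \<le> 0"
  proof (rule LIMSEQ_le_const)
    show "(\<lambda>m. C * G / (real (Suc m))\<^sup>2) \<longlonglongrightarrow> 0"
      by real_asymp
    have "prob Bad \<le> C * G / (real (Suc m))\<^sup>2" for m
    proof -
      have "prob Bad \<le> prob (\<Union>n. E (real (Suc m)) n)"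
        by (intro finite_measure_mono) (auto simp: Bad_def)
      with prob_UN[of "real (Suc m)"] show ?thesis by simp
    qed
    then show "\<exists>m0. \<forall>m\<ge>m0. prob Bad \<le> C * G / (real (Suc m))\<^sup>2" by blast
  qed
  then have "prob Bad = 0"
    using measure_nonneg[of M Bad] by linarith
  then have "AE s in M. s \<notin> Bad"
    by (intro AE_not_in) (auto simp: null_sets_def emeasure_eq_measure)
  then show ?thesis
    using AE_space
  proof eventually_elim
    case (elim s)
    then obtain m where "\<And>n. \<bar>T (real (Suc m)) n s\<bar> \<le> real (Suc m)"
      by (auto simp: Bad_def E_def not_less)
    then have "\<bar>\<Sum>i<n. x s i\<bar> \<le> real (Suc m)" for n
      unfolding T_def using stopped_sum_eq_sum by metis
    then show ?case by (auto simp: x_def)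
  qed
qed

section \<open>Projection onto a polytope and the minimizing vertex\<close>

text \<open>The condition places \<open>y - x\<close> in the normal cone at \<open>x\<close>. It is
  linear in the test point, so it extends from the generators to the hull, and expanding
  \<open>(norm (y - z))\<^sup>2\<close> around \<open>x\<close> shows that no \<open>z\<close> in
  the hull is closer.\<close>

lemma closest_point_convex_hull_eqI:
  fixes x y :: "'a::euclidean_space"
  assumes V: "finite V" and x: "x \<in> convex hull V" and le: "\<And>v. v \<in> V \<Longrightarrow> (y - x) \<bullet> (v - x) \<le> 0"
  shows "closest_point (convex hull V) y = x"
proof -
  have "convex hull V \<subseteq> {z. (y - x) \<bullet> z \<le> (y - x) \<bullet> x}"
    using le by (intro hull_minimal convex_halfspace_le) (auto simp: inner_diff_right)
  then have *: "(y - x) \<bullet> (z - x) \<le> 0" if "z \<in> convex hull V" for z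
    using that by (auto simp: inner_diff_right)
  have "dist y x \<le> dist y z" if z: "z \<in> convex hull V" for z
  proof -
    have "(norm (y - z))\<^sup>2 = (norm (y - x))\<^sup>2 - 2 * ((y - x) \<bullet> (z - x)) + (norm (z - x))\<^sup>2"
      unfolding power2_norm_eq_inner by (simp add: inner_diff_left inner_diff_right inner_commute)
    with *[OF z] have "(norm (y - x))\<^sup>2 \<le> (norm (y - z))\<^sup>2"
      using zero_le_power2[of "norm (z - x)"] by linarith
    then show ?thesis
      unfolding dist_norm by (rule power2_le_imp_le) simp
  qed
  then show ?thesis
    using V x by (intro closest_point_unique[symmetric] convex_convex_hull compact_imp_closed finite_imp_compact_convex_hull) auto
qed

text \<open>The deterministic part, for one fixed path: in each direction \<open>v - x\<close> the
  divergent drift outweighs the bounded noise, and as \<open>V\<close> is finite all directions are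
  settled from a common time on.\<close>

lemma eventually_closest_point_eq_vertex:
  fixes Z G :: "nat \<Rightarrow> 'a::euclidean_space"
  assumes V: "finite V" and x: "x \<in> convex hull V"
    and step: "\<And>n. Z (Suc n) = Z n - \<gamma> n *\<^sub>R G n"
    and div: "filterlim (\<lambda>n. \<Sum>i<n. \<gamma> i) at_top sequentially"
    and c: "\<And>v. v \<in> V \<Longrightarrow> v \<noteq> x \<Longrightarrow> c \<bullet> (v - x) > 0"
    and noise: "\<And>v. v \<in> V \<Longrightarrow> \<exists>B. \<forall>n. \<bar>\<Sum>i<n. \<gamma> i * (G i \<bullet> (v - x) - c \<bullet> (v - x))\<bar> \<le> B"
  shows "\<forall>\<^sub>F n in sequentially. closest_point (convex hull V) (Z n) = x"
proof -
  have "\<forall>\<^sub>F n in sequentially. (Z n - x) \<bullet> (v - x) \<le> 0" if v: "v \<in> V" for v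
  proof (cases "v = x")
    case False
    let ?u = "v - x"
    from noise[OF v] obtain B where B: "\<And>n. \<bar>\<Sum>i<n. \<gamma> i * (G i \<bullet> ?u - c \<bullet> ?u)\<bar> \<le> B" by blast
    \<comment> \<open>Unrolling the recursion separates initial value, noise and drift. Hence the
      left side is nonpositive as soon as the summed step sizes pass
      \<open>((Z 0 - x) \<bullet> ?u + B) / (c \<bullet> ?u)\<close>.\<close>
    have Z: "(Z n - x) \<bullet> ?u = (Z 0 - x) \<bullet> ?u - (\<Sum>i<n. \<gamma> i * (G i \<bullet> ?u - c \<bullet> ?u)) - (\<Sum>i<n. \<gamma> i) * (c \<bullet> ?u)" for n
      by (induction n) (simp_all add: step inner_diff_left algebra_simps)
    have "\<forall>\<^sub>F n in sequentially. ((Z 0 - x) \<bullet> ?u + B) / (c \<bullet> ?u) \<le> (\<Sum>i<n. \<gamma> i)"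
      using div by (simp add: filterlim_at_top)
    then show ?thesis
    proof eventually_elim
      case (elim n)
      then have "(Z 0 - x) \<bullet> ?u + B \<le> (\<Sum>i<n. \<gamma> i) * (c \<bullet> ?u)"
        using c[OF v False] by (simp add: pos_divide_le_eq)
      then show ?case
        using Z[of n] abs_le_D2[OF B[of n]] by linarith
    qed
  qed simp
  then have "\<forall>\<^sub>F n in sequentially. \<forall>v\<in>V. (Z n - x) \<bullet> (v - x) \<le> 0"
    using V by (intro eventually_ball_finite) auto
  then show ?thesis
    by eventually_elim (use V x in \<open>auto intro: closest_point_convex_hull_eqI\<close>)
qed

text \<open>The minimizers of \<open>c\<close> over \<open>S\<close> form an exposed face on which
  \<open>f\<close> is constant; genericity makes it zero-dimensional, that is, a single point.
  Uniqueness then gives the strict inequality.\<close>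

lemma generic_linear_program_minimizer:
  fixes S :: "'a::euclidean_space set"
  assumes generic: "generic_linear_program S f" and S: "S \<noteq> {}" "compact S" "convex S"
    and f: "\<And>x. x \<in> S \<Longrightarrow> f x = c \<bullet> x + b"
  obtains xstar where "minimizers_on S f = {xstar}" "xstar \<in> S"
    "\<And>x. x \<in> S \<Longrightarrow> x \<noteq> xstar \<Longrightarrow> c \<bullet> (x - xstar) > 0"
proof -
  obtain m where m: "m \<in> S" "\<And>x. x \<in> S \<Longrightarrow> c \<bullet> m \<le> c \<bullet> x"
    using continuous_attains_inf[OF S(2,1), of "\<lambda>x. c \<bullet> x"] continuous_on_inner[OF continuous_on_const continuous_on_id]
    by blast
  define C where "C = S \<inter> {x. c \<bullet> x = c \<bullet> m}"
  have "C face_of S"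
    unfolding C_def using S(3) m(2) by (rule face_of_Int_supporting_hyperplane_ge)
  moreover have "C \<noteq> {}"
    using m(1) by (auto simp: C_def)
  moreover have "f constant_on C"
    unfolding constant_on_def by (rule exI[of _ "c \<bullet> m + b"]) (simp add: C_def f)
  ultimately have "aff_dim C = 0"
    using generic by (simp add: generic_linear_program_def)
  then obtain a where a: "C = {a}"
    by (auto simp: aff_dim_eq_0)
  then have C: "\<And>x. x \<in> S \<Longrightarrow> c \<bullet> x = c \<bullet> m \<Longrightarrow> x = a"
    by (auto simp: C_def)
  then have am: "a = m" using m(1) by auto
  show ?thesis
  proof (rule that)
    show pos: "c \<bullet> (x - a) > 0" if "x \<in> S" "x \<noteq> a" for x
      using m(2)[of x] C[of x] that am by (force simp: inner_diff_right)
    show "minimizers_on S f = {a}"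
    proof (intro equalityI subsetI)
      fix x assume x: "x \<in> minimizers_on S f"
      then have "x \<in> S" "f x \<le> f m" using m(1) by (auto simp: minimizers_on_def)
      then show "x \<in> {a}" using C[of x] m(2)[of x] f m(1) by auto
    next
      fix x assume "x \<in> {a}"
      then show "x \<in> minimizers_on S f" using m am f by (auto simp: minimizers_on_def)
    qed
  qed (use m am in simp)
qed

section \<open>Application to the SGD trajectory\<close>

lemma (in prob_space) indep_vars_Suc:
  assumes "indep_vars (\<lambda>_. N) W {1::nat..}"
  shows "indep_vars (\<lambda>_. N) (\<lambda>n. W (Suc n)) UNIV"
proof -
  have "indep_vars (\<lambda>n. PiM {Suc n} (\<lambda>_. N)) (\<lambda>n s. restrict (\<lambda>i. W i s) {Suc n}) UNIV"
    by (rule indep_vars_restrict[OF assms]) (auto simp: disjoint_family_on_def)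
  from indep_vars_compose2[OF this, of "\<lambda>n w. w (Suc n)" "\<lambda>_. N"]
  show ?thesis by (simp add: measurable_component_singleton)
qed

theorem corollary6p6:
  fixes \<X> :: "'a::euclidean_space set"
    and M :: "'w measure"
    and F :: "'a \<Rightarrow> 'w \<Rightarrow> real"
    and gradF :: "'a \<Rightarrow> 'w \<Rightarrow> 'a"
    and f :: "'a \<Rightarrow> real"
    and V :: real
    and \<gamma> :: "nat \<Rightarrow> real"
    and y1 :: 'a
    and S :: "'s measure"
    and W :: "nat \<Rightarrow> 's \<Rightarrow> 'w"
    and X Y :: "nat \<Rightarrow> 's \<Rightarrow> 'a"
  assumes "\<X> \<noteq> {}" and "compact \<X>" and "convex \<X>"
    and "prob_space M" and "complete_measure M"
    and F_integrable: "\<And>x. x \<in> \<X> \<Longrightarrow> integrable M (F x)"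
    and f_eq: "\<And>x. x \<in> \<X> \<Longrightarrow> f x = prob_space.expectation M (F x)"
    and F_C1: "AE \<omega> in M. C1_with_gradient_on \<X> (\<lambda>x. F x \<omega>) (\<lambda>x. gradF x \<omega>)"
    and grad_meas: "\<And>x. x \<in> \<X> \<Longrightarrow> gradF x \<in> borel_measurable M"
    and "V \<ge> 0"
    and grad_sq_integrable: "\<And>x. x \<in> \<X> \<Longrightarrow> integrable M (\<lambda>\<omega>. (norm (gradF x \<omega>))\<^sup>2)"
    and grad_sq_bound:
      "\<And>x. x \<in> \<X> \<Longrightarrow> prob_space.expectation M (\<lambda>\<omega>. (norm (gradF x \<omega>))\<^sup>2) \<le> V\<^sup>2"
    and generic: "generic_linear_program \<X> f"
    and step_pos: "\<And>n. n \<ge> 1 \<Longrightarrow> \<gamma> n > 0"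
    and step_sq: "summable (\<lambda>n. (\<gamma> n)\<^sup>2)"
    and step_div: "filterlim (\<lambda>N. \<Sum>n=1..N. \<gamma> n) at_top sequentially"
    and "prob_space S"
    and samples: "iid_samples S M W"
    and sgd: "\<And>s. s \<in> space S \<Longrightarrow>
      lazy_sgd_path \<X> gradF \<gamma> y1 (\<lambda>n. W n s) (\<lambda>n. X n s) (\<lambda>n. Y n s)"
  shows "\<exists>xstar. minimizers_on \<X> f = {xstar} \<and>
           (AE s in S. \<forall>\<^sub>F n in sequentially. X n s = xstar)"
proof -
  interpret M: prob_space M by fact
  interpret S: prob_space S by fact
  interpret field: C1_random_field M \<X> F gradF V
    using assms by unfold_locales auto
  obtain c b where cb: "\<And>x. x \<in> \<X> \<Longrightarrow> f x = c \<bullet> x + b"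
    using generic by (auto simp: generic_linear_program_def affine_function_on_def)
  obtain xstar where xstar: "minimizers_on \<X> f = {xstar}" "xstar \<in> \<X>"
    and sharp: "\<And>x. x \<in> \<X> \<Longrightarrow> x \<noteq> xstar \<Longrightarrow> c \<bullet> (x - xstar) > 0"
    using generic_linear_program_minimizer[OF generic \<open>\<X> \<noteq> {}\<close> \<open>compact \<X>\<close> \<open>convex \<X>\<close> cb] by blast
  obtain U where U: "finite U" "\<X> = convex hull U"
    using generic by (auto simp: generic_linear_program_def polytope_def)
  have closed: "closed \<X>"
    using \<open>compact \<X>\<close> by (rule compact_imp_closed)
  have proj: "closest_point \<X> y \<in> \<X>" for y
    using closed \<open>\<X> \<noteq> {}\<close> by (rule closest_point_in_set)
  have EF: "M.expectation (F z) = c \<bullet> z + b" if "z \<in> \<X>" for z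
    using cb f_eq that by simp
  \<comment> \<open>One measurable null set serves all feasible points at once: outside it the whole
    section is continuously differentiable.\<close>
  obtain N0 where N0: "N0 \<in> null_sets M" "{\<omega> \<in> space M. \<not> C1_with_gradient_on \<X> (\<lambda>x. F x \<omega>) (\<lambda>x. gradF x \<omega>)} \<subseteq> N0"
    using F_C1 by (auto simp: eventually_ae_filter)
  \<comment> \<open>\<open>gradF\<close> need not be jointly measurable; \<open>H\<close> is, being continuous in \<open>y\<close> for every \<open>\<omega>\<close>.\<close>
  define H where "H y \<omega> = (if \<omega> \<in> N0 then 0 else gradF (closest_point \<X> y) \<omega>)" for y \<omega>
  have H_meas: "(\<lambda>(y, \<omega>). H y \<omega>) \<in> borel_measurable (borel \<Otimes>\<^sub>M M)"
  proof (rule borel_measurable_pair_Caratheodory)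
    show "H y \<in> borel_measurable M" for y
      unfolding H_def using N0(1) grad_meas[OF proj]
      by (intro measurable_If_set) auto
    show "continuous_on UNIV (\<lambda>y. H y \<omega>)" if "\<omega> \<in> space M" for \<omega>
    proof (cases "\<omega> \<in> N0")
      case False
      then have "continuous_on \<X> (\<lambda>x. gradF x \<omega>)"
        using N0(2) that by (auto simp: C1_with_gradient_on_def)
      then have "continuous_on UNIV (\<lambda>y. gradF (closest_point \<X> y) \<omega>)"
        by (rule continuous_on_compose2[OF _ continuous_on_closest_point[OF \<open>convex \<X>\<close> closed \<open>\<X> \<noteq> {}\<close>]])
          (use proj in auto)
      then show ?thesis using False by (simp add: H_def)
    qed (simp add: H_def)
  qed
  have H_meas' [measurable]: "(\<lambda>p. H (fst p) (snd p)) \<in> borel_measurable (borel \<Otimes>\<^sub>M M)"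
    using H_meas by (simp add: case_prod_beta')
  have [measurable]: "H y \<in> borel_measurable M" for y
    using measurable_compose[OF measurable_Pair1' H_meas, of y] by simp
  have H_AE: "AE \<omega> in M. H y \<omega> = gradF (closest_point \<X> y) \<omega>" for y
    using AE_not_in[OF N0(1)] by eventually_elim (simp add: H_def)
  \<comment> \<open>The iterates start at index 1 and the recursion lemmas at 0; samples and step
    sizes are shifted so that \<open>Z n\<close> below corresponds to
    \<open>Y (Suc n)\<close>.\<close>
  define W' where "W' n = W (Suc n)" for n
  have ind: "S.indep_vars (\<lambda>_. M) W' UNIV" and dist: "distr S M (W' n) = M" for n
    using samples S.indep_vars_Suc by (auto simp: iid_samples_def W'_def[abs_def])
  have W'_meas: "W' n \<in> measurable S M" for n
    using ind by (auto simp: S.indep_vars_def)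
  define \<gamma>' where "\<gamma>' n = \<gamma> (Suc n)" for n
  have \<gamma>'_sq: "summable (\<lambda>n. (\<gamma>' n)\<^sup>2)"
    using step_sq summable_Suc_iff[of "\<lambda>n. (\<gamma> n)\<^sup>2"] by (simp add: \<gamma>'_def)
  have \<gamma>'_div: "filterlim (\<lambda>n. \<Sum>i<n. \<gamma>' i) at_top sequentially"
    using step_div by (simp add: \<gamma>'_def sum.atLeast1_atMost_eq)
  \<comment> \<open>The recursion of \<open>Y\<close> with \<open>H\<close> in place of
    \<open>gradF\<close>. Its update map is jointly measurable, as the noise bound requires;
    agreement with \<open>Y\<close> is shown only on paths whose samples avoid
    \<open>N0\<close>.\<close>
  define Z where "Z n s = rec_nat y1 (\<lambda>n z. z - \<gamma>' n *\<^sub>R H z (W' n s)) n" for n s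
  have Z0: "Z 0 s = y1" and ZSuc: "Z (Suc n) s = Z n s - \<gamma>' n *\<^sub>R H (Z n s) (W' n s)" for n s
    by (simp_all add: Z_def)
  have noise: "AE s in S. \<exists>B. \<forall>n. \<bar>\<Sum>i<n. \<gamma>' i * (H (Z i s) (W' i s) \<bullet> (v - xstar) - c \<bullet> (v - xstar))\<bar> \<le> B"
    if v: "v \<in> \<X>" for v
  proof -
    let ?u = "v - xstar"
    define h where "h p = H (fst p) (snd p) \<bullet> ?u - c \<bullet> ?u" for p
    \<comment> \<open>The second-moment bound for \<open>H y \<omega> \<bullet> ?u\<close> plus the
      squared mean; it dominates the variance, which is what the expansion of \<open>h\<close>
      yields.\<close>
    define C where "C = V\<^sup>2 * (norm ?u)\<^sup>2 + (c \<bullet> ?u)\<^sup>2"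
    have H_u: "integrable M (\<lambda>\<omega>. H y \<omega> \<bullet> ?u)" "M.expectation (\<lambda>\<omega>. H y \<omega> \<bullet> ?u) = c \<bullet> ?u"
      and H_u_sq: "integrable M (\<lambda>\<omega>. (H y \<omega> \<bullet> ?u)\<^sup>2)" "M.expectation (\<lambda>\<omega>. (H y \<omega> \<bullet> ?u)\<^sup>2) \<le> V\<^sup>2 * (norm ?u)\<^sup>2" for y
    proof -
      let ?x = "closest_point \<X> y"
      note [measurable] = grad_meas[OF proj]
      have "integrable M (\<lambda>\<omega>. (H y \<omega> \<bullet> ?u)\<^sup>2) \<longleftrightarrow> integrable M (\<lambda>\<omega>. (gradF ?x \<omega> \<bullet> ?u)\<^sup>2)"
        by (rule integrable_cong_AE) (use H_AE[of y] in \<open>auto elim!: eventually_mono\<close>)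
      with field.gradient_inner_sq(1)[OF proj]
      show sq: "integrable M (\<lambda>\<omega>. (H y \<omega> \<bullet> ?u)\<^sup>2)" by simp
      show "integrable M (\<lambda>\<omega>. H y \<omega> \<bullet> ?u)"
        by (rule M.square_integrable_imp_integrable[OF _ sq]) measurable
      have "M.expectation (\<lambda>\<omega>. H y \<omega> \<bullet> ?u) = M.expectation (\<lambda>\<omega>. gradF ?x \<omega> \<bullet> ?u)"
        by (rule integral_cong_AE) (use H_AE[of y] in \<open>auto elim!: eventually_mono\<close>)
      also have "\<dots> = c \<bullet> ?u"
        by (rule field.expectation_gradient_inner'[OF EF proj xstar(2) v])
      finally show "M.expectation (\<lambda>\<omega>. H y \<omega> \<bullet> ?u) = c \<bullet> ?u" .
      have "M.expectation (\<lambda>\<omega>. (H y \<omega> \<bullet> ?u)\<^sup>2) = M.expectation (\<lambda>\<omega>. (gradF ?x \<omega> \<bullet> ?u)\<^sup>2)"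
        by (rule integral_cong_AE) (use H_AE[of y] in \<open>auto elim!: eventually_mono\<close>)
      with field.gradient_inner_sq(2)[OF proj]
      show "M.expectation (\<lambda>\<omega>. (H y \<omega> \<bullet> ?u)\<^sup>2) \<le> V\<^sup>2 * (norm ?u)\<^sup>2" by simp
    qed
    have "AE s in S. \<exists>B. \<forall>n. \<bar>\<Sum>i<n. \<gamma>' i * h (Z i s, W' i s)\<bar> \<le> B"
    proof -
      let ?\<Phi> = "\<lambda>n p. fst p - \<gamma>' n *\<^sub>R H (fst p) (snd p)"
      show ?thesis
      proof (rule S.AE_bounded_noise_sum[where N = M and W = W' and Z = Z and ?z0.0 = y1 and Q = borel
            and \<Phi> = ?\<Phi> and h = h and C = C and \<gamma> = \<gamma>'])
        show "Z (Suc n) s = ?\<Phi> n (Z n s, W' n s)" for n s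
          by (simp add: ZSuc)
        show "?\<Phi> n \<in> measurable (borel \<Otimes>\<^sub>M M) borel" for n
          by measurable
        show "h \<in> borel_measurable (borel \<Otimes>\<^sub>M M)"
          unfolding h_def by measurable
        show "(\<integral>\<omega>. h (y, \<omega>) \<partial>M) = 0" for y
          using H_u by (simp add: h_def M.prob_space)
        show "(\<integral>\<^sup>+\<omega>. ennreal ((h (y, \<omega>))\<^sup>2) \<partial>M) \<le> ennreal C" for y
        proof -
          have eq: "(h (y, \<omega>))\<^sup>2 = (H y \<omega> \<bullet> ?u)\<^sup>2 - 2 * (c \<bullet> ?u) * (H y \<omega> \<bullet> ?u) + (c \<bullet> ?u)\<^sup>2" for \<omega>
            by (simp add: h_def power2_diff mult_ac)
          have "integrable M (\<lambda>\<omega>. (h (y, \<omega>))\<^sup>2)"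
            unfolding eq using H_u H_u_sq by simp
          then have "(\<integral>\<^sup>+\<omega>. ennreal ((h (y, \<omega>))\<^sup>2) \<partial>M) = ennreal (M.expectation (\<lambda>\<omega>. (h (y, \<omega>))\<^sup>2))"
            by (rule nn_integral_eq_integral) simp
          also have "\<dots> \<le> ennreal C"
          proof (rule ennreal_leI)
            have "M.expectation (\<lambda>\<omega>. (h (y, \<omega>))\<^sup>2) = M.expectation (\<lambda>\<omega>. (H y \<omega> \<bullet> ?u)\<^sup>2) - (c \<bullet> ?u)\<^sup>2"
              unfolding eq using H_u H_u_sq by (simp add: M.prob_space power2_eq_square)
            then show "M.expectation (\<lambda>\<omega>. (h (y, \<omega>))\<^sup>2) \<le> C"
              using H_u_sq(2)[of y] zero_le_power2[of "c \<bullet> ?u"] unfolding C_def by linarith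
          qed
          finally show ?thesis .
        qed
        show "C \<ge> 0" by (simp add: C_def)
      qed (use ind dist Z0 \<gamma>'_sq in auto)
    qed
    then show ?thesis by (simp add: h_def)
  qed
  have "U \<subseteq> \<X>"
    unfolding U(2) by (rule hull_subset)
  then have "AE s in S. \<forall>v\<in>U. \<exists>B. \<forall>n. \<bar>\<Sum>i<n. \<gamma>' i * (H (Z i s) (W' i s) \<bullet> (v - xstar) - c \<bullet> (v - xstar))\<bar> \<le> B"
    using noise U(1) by (intro AE_finite_allI) auto
  \<comment> \<open>Each sample has law \<open>M\<close> and there are countably many, so almost
    surely none ever lands in \<open>N0\<close>; on such paths \<open>H\<close> at the state is the
    gradient that SGD uses.\<close>
  moreover have "AE s in S. \<forall>n. W' n s \<notin> N0"
  proof (subst AE_all_countable, rule allI)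
    fix n
    have "AE \<omega> in distr S M (W' n). \<omega> \<notin> N0"
      unfolding dist by (rule AE_not_in[OF N0(1)])
    then show "AE s in S. W' n s \<notin> N0"
      by (rule AE_distrD[OF W'_meas])
  qed
  ultimately have "AE s in S. \<forall>\<^sub>F n in sequentially. X n s = xstar"
    using AE_space
  proof eventually_elim
    case (elim s)
    from sgd[OF elim(3)] have Y1: "Y 1 s = y1"
      and X: "\<And>n. n \<ge> 1 \<Longrightarrow> X n s = closest_point \<X> (Y n s)"
      and YSuc: "\<And>n. n \<ge> 1 \<Longrightarrow> Y (Suc n) s = Y n s - \<gamma> n *\<^sub>R gradF (X n s) (W n s)"
      by (auto simp: lazy_sgd_path_def)
    have ZY: "Z n s = Y (Suc n) s" for n
    proof (induction n)
      case (Suc n)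
      then show ?case
        using elim(2) X[of "Suc n"] YSuc[of "Suc n"] by (simp add: ZSuc H_def \<gamma>'_def W'_def)
    qed (use Y1 in \<open>simp add: Z0\<close>)
    have "\<forall>\<^sub>F n in sequentially. closest_point (convex hull U) (Z n s) = xstar"
    proof (rule eventually_closest_point_eq_vertex[OF U(1), where c = c])
      show "xstar \<in> convex hull U" using xstar(2) U(2) by simp
      show "c \<bullet> (v - xstar) > 0" if "v \<in> U" "v \<noteq> xstar" for v
        using sharp that \<open>U \<subseteq> \<X>\<close> by blast
      show "Z (Suc n) s = Z n s - \<gamma>' n *\<^sub>R H (Z n s) (W' n s)" for n
        by (rule ZSuc)
    qed (use \<gamma>'_div elim(1) in auto)
    then have "\<forall>\<^sub>F n in sequentially. X (Suc n) s = xstar"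
      by (simp add: X ZY U(2))
    then show ?case
      by (rule eventually_sequentially_Suc[THEN iffD1])
  qed
  with xstar(1) show ?thesis by blast
qed

end
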